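(* Let $\beta\in(0,+\infty)$, and let $m,n\to\infty$ in such a way that $m/n\to\beta$. For each $(n,m)$ let $P=P_{n,m}$ be a probability distribution on $\{0,1,\dots,m\}$, let $d=d(w_1)$ be the degree of vertex $w_1$ in the passive random intersection graph $G^*(n,m,P)$, and let $X_1=|D_1|$ (so that $X_1$ has distribution $P$). Let $Z$ be a random variable and assume that (i) $X_1$ converges in distribution to $Z$; (ii) $0<\mathbf{E}Z<\infty$ and $\lim_{m\to\infty}\mathbf{E}X_1=\mathbf{E}Z$. Then $d$ converges in distribution to the compound Poisson random variable $$d_*=\sum_{j=1}^{\Lambda}\tilde Z_j,$$ where $\tilde Z_1,\tilde Z_2,\dots$ are independent random variables with the common probability distribution $\tilde P_Z$, i.e. $\mathbf{P}(\tilde Z_1=j)=(j+1)\mathbf{P}(Z=j+1)/\mathbf{E}Z$ for $j=0,1,2,\dots$, and the random variable $\Lambda$ is independent of the sequence $\tilde Z_1,\tilde Z_2,\dots$ and has the Poisson distribution with mean $\mathbf{E}\Lambda=\beta^{-1}\mathbf{E}Z$.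
   Context: Passive random intersection graph $G^*(n,m,P)$: let $P$ be a probability distribution on $\{0,1,\dots,m\}$ and let $D_1,\dots,D_n$ be independent random subsets of $W=\{w_1,\dots,w_m\}$ having the same probability distribution $\mathbf{P}(D_i=A)=\binom{m}{|A|}^{-1}P(|A|)$, $A\subset W$. The graph $G^*(n,m,P)$ has vertex set $W$, and two distinct vertices $w,w'\in W$ are adjacent whenever $w,w'\in D_j$ for some $j\in\{1,\dots,n\}$. The degree of $w_1$ is the number of vertices of $W\setminus\{w_1\}$ adjacent to $w_1$. $P_\xi$ denotes the probability distribution of a random variable $\xi$. For a probability distribution $Q$ on $\{0,1,2,\dots\}$ with finite positive first moment $\mu_Q=\sum_i iQ(i)$, the size biased distribution $\tilde Q$ is $\tilde Q(j)=(j+1)Q(j+1)\mu_Q^{-1}$, $j=0,1,\dots$; thus $\tilde P_Z$ is the size biased distribution of $P_Z$ (the limit $Z$ takes values in $\{0,1,2,\dots\}$ almost surely). All limits are along the given sequence of pairs $(n,m)$ with $n,m\to\infty$ and $m/n\to\beta$. An empty sum equals $0$. *)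

theory Defs
  imports "HOL-Probability.Probability"
begin

definition passive_adjacent ::
    "'v set \<Rightarrow> nat \<Rightarrow> (nat \<Rightarrow> 'v set) \<Rightarrow> 'v \<Rightarrow> 'v \<Rightarrow> bool" where
  "passive_adjacent W n S v w \<longleftrightarrow>
     v \<in> W \<and> w \<in> W \<and> v \<noteq> w \<and> (\<exists>j\<in>{1..n}. v \<in> S j \<and> w \<in> S j)"

definition passive_degree :: "'v set \<Rightarrow> nat \<Rightarrow> (nat \<Rightarrow> 'v set) \<Rightarrow> 'v \<Rightarrow> nat" where
  "passive_degree W n S v = card {w \<in> W - {v}. passive_adjacent W n S v w}"

(* Vertex w_i is encoded as the number i.  Using count_space (Pow {1..m}) as the target
   space makes each D i measurable with values in the subsets of {1..m}. *)
definition passive_random_sets ::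
    "'a measure \<Rightarrow> nat \<Rightarrow> nat \<Rightarrow> nat pmf \<Rightarrow> (nat \<Rightarrow> 'a \<Rightarrow> nat set) \<Rightarrow> bool" where
  "passive_random_sets M n m P D \<longleftrightarrow>
     prob_space M \<and>
     set_pmf P \<subseteq> {0..m} \<and>
     prob_space.indep_vars M (\<lambda>_. count_space (Pow {1..m})) D {1..n} \<and>
     (\<forall>i\<in>{1..n}. \<forall>A\<subseteq>{1..m}.
        measure M {\<omega> \<in> space M. D i \<omega> = A} = pmf P (card A) / real (m choose card A))"

definition converges_in_distribution ::
    "(nat \<Rightarrow> 'a measure) \<Rightarrow> (nat \<Rightarrow> 'a \<Rightarrow> real) \<Rightarrow> 'b measure \<Rightarrow> ('b \<Rightarrow> real) \<Rightarrow> bool" where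
  "converges_in_distribution M X N Y \<longleftrightarrow>
     weak_conv_m (\<lambda>k. distr (M k) borel (X k)) (distr N borel Y)"

end

theory Submission
  imports Defs
begin

text \<open>
  The proof compares probability generating functions. Fix t in (0,1) and let A be a uniformly
  random subset of the other m - 1 vertices, of size a with a/m tending to 1 - t. Given the graph,
  the probability that A contains no neighbour of vertex 1 is close to t^d, uniformly in d. Given A,
  it is exactly (1 - q)^n, because the sets D_j are independent, where
  q = E(X(1 - h(X - 1)))/m and h(r) is close to t^r. Hence E(t^d) tends to
  exp(-(E Z - E(Z t^(Z-1)))/\<beta>), which is the generating function of the compound Poisson
  limit. As the whole argument is an identity followed by a limit, no second moment and no coupling
  is needed. Convergence of generating functions on (0,1) gives convergence of the point
  probabilities.
\<close>

text \<open>The degree is the size of a union of overlapping sets, not a sum of independent terms.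
  Testing that union against a set \<open>A\<close> removes the overlaps: "\<open>A\<close> contains
  no neighbour of vertex 1" is an intersection over j of events that each concern \<open>D j\<close>
  alone. Fixing the size of \<open>A\<close>, instead of selecting vertices independently with
  probability 1 - t, keeps the right-hand side a single n-th power. The price is that t^d is
  replaced by a hypergeometric probability, and the approximation has to be uniform because no
  tightness of the degree is known in advance. Uniformity also decides how (ii) enters. The
  integrand X(1 - h(X-1)) is unbounded, so convergence in distribution alone does not control it. It
  is split into X, whose mean converges by (ii), and X h(X-1), which differs from X t^(X-1) by at
  most a uniform error times X; the function x t^(x-1) is bounded and extends continuously to the
  reals. Since Z is an arbitrary real random variable, it is first shown to be almost surely a
  natural number.\<close>

section \<open>Generating functions and convergence in distribution\<close>

text \<open>For small t everything beyond the constant term is at most t B / (1 - t), uniformly in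
  k, so the constant coefficients tend to 0. Subtracting them and dividing by t leaves the shifted
  series, which satisfies the same hypotheses with the same \<open>B\<close>; induction on the index
  then reaches every coefficient.\<close>

lemma power_series_coeff_tendsto_0:
  fixes c :: "nat \<Rightarrow> nat \<Rightarrow> real"
  assumes bound: "\<And>k j. \<bar>c k j\<bar> \<le> B"
    and lim: "\<And>t. 0 < t \<Longrightarrow> t < 1 \<Longrightarrow> (\<lambda>k. \<Sum>j. c k j * t ^ j) \<longlonglongrightarrow> 0"
  shows "(\<lambda>k. c k j) \<longlonglongrightarrow> 0"
  using assms
proof (induction j arbitrary: c)
  have B: "0 \<le> B" if "\<And>k j. \<bar>c k j\<bar> \<le> B" for c :: "nat \<Rightarrow> nat \<Rightarrow> real"
    using that[of 0 0] by linarith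
  have sm: "summable (\<lambda>j. c k j * t ^ j)"
    if "0 < t" "t < 1" "\<And>k j. \<bar>c k j\<bar> \<le> B" for t :: real and k and c :: "nat \<Rightarrow> nat \<Rightarrow> real"
  proof (rule summable_comparison_test'[where g = "\<lambda>j. B * t ^ j" and N = 0])
    show "summable (\<lambda>j. B * t ^ j)" using that by (intro summable_mult summable_geometric) auto
    show "norm (c k j * t ^ j) \<le> B * t ^ j" for j
      using that by (auto simp: abs_mult intro!: mult_right_mono)
  qed
  have split: "(\<Sum>j. c k j * t ^ j) = c k 0 + t * (\<Sum>j. c k (Suc j) * t ^ j)"
    if "0 < t" "t < 1" "\<And>k j. \<bar>c k j\<bar> \<le> B" for t :: real and k and c :: "nat \<Rightarrow> nat \<Rightarrow> real"
  proof -
    have "(\<Sum>j. c k j * t ^ j) = (\<Sum>j. c k (Suc j) * t ^ Suc j) + c k 0"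
      using suminf_split_head[OF sm[where c = c and k = k, OF that]] by simp
    also have "(\<Sum>j. c k (Suc j) * t ^ Suc j) = (\<Sum>j. t * (c k (Suc j) * t ^ j))"
      by (simp add: algebra_simps)
    also have "\<dots> = t * (\<Sum>j. c k (Suc j) * t ^ j)"
      using sm[where c = "\<lambda>k j. c k (Suc j)" and k = k, OF that(1,2) that(3)] by (subst suminf_mult) auto
    finally show ?thesis by simp
  qed
  have base: "(\<lambda>k. c k 0) \<longlonglongrightarrow> 0"
    if bd: "\<And>k j. \<bar>c k j\<bar> \<le> B"
      and lim: "\<And>t. 0 < t \<Longrightarrow> t < 1 \<Longrightarrow> (\<lambda>k. \<Sum>j. c k j * t ^ j) \<longlonglongrightarrow> 0"
    for c :: "nat \<Rightarrow> nat \<Rightarrow> real"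
  proof (rule LIMSEQ_I)
    fix e :: real assume e: "0 < e"
    \<comment> \<open>The bound 1/2 makes 1/(1 - t) at most 2, and the other bound makes the tail 2
      t B smaller than e/2. \<open>B + 1\<close> keeps the denominator positive when
      \<open>B\<close> is 0.\<close>
    define t where "t = min (1/2) (e / (4 * (B + 1)))"
    have t2: "t \<le> 1/2" unfolding t_def by (rule min.cobounded1)
    have "0 < t" using e B[where c = c, OF bd] by (simp add: t_def)
    then have t: "0 < t" "t < 1" "t \<le> 1/2" using t2 by auto
    have "t \<le> e / (4 * (B + 1))" unfolding t_def by (rule min.cobounded2)
    then have "t * (4 * (B + 1)) \<le> e"
      using B[where c = c, OF bd] by (subst (asm) pos_le_divide_eq) auto
    then have te: "2 * t * B < e / 2" using t e B[where c = c, OF bd] by (simp add: algebra_simps)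
    have rest: "\<bar>t * (\<Sum>j. c k (Suc j) * t ^ j)\<bar> \<le> 2 * t * B" for k
    proof -
      have 1: "summable (\<lambda>j. B * t ^ j)" using t by (intro summable_mult summable_geometric) auto
      have "norm (\<Sum>j. c k (Suc j) * t ^ j) \<le> (\<Sum>j. B * t ^ j)"
        by (rule norm_suminf_le[OF _ 1]) (use bd t in \<open>auto simp: abs_mult intro!: mult_right_mono\<close>)
      also have "\<dots> = B * (1 / (1 - t))"
        using t by (subst suminf_mult) (auto simp: suminf_geometric intro: summable_geometric)
      also have "\<dots> \<le> B * 2"
        using t B[where c = c, OF bd] by (intro mult_left_mono) (auto simp: field_simps)
      finally show ?thesis using t by (simp add: abs_mult)
    qed
    from LIMSEQ_D[OF lim[OF t(1,2)], of "e / 2"] e obtain K where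
      K: "\<And>k. k \<ge> K \<Longrightarrow> \<bar>\<Sum>j. c k j * t ^ j\<bar> < e / 2" by auto
    show "\<exists>no. \<forall>n\<ge>no. norm (c n 0 - 0) < e"
    proof (intro exI[of _ K] allI impI)
      fix k assume "K \<le> k"
      from K[OF this] rest[of k] split[where c = c and k = k, OF t(1,2) bd] te
      have "\<bar>c k 0\<bar> < e" by linarith
      then show "norm (c k 0 - 0) < e" by simp
    qed
  qed
  {
    case 0
    then show ?case by (rule base)
  next
    case (Suc j)
    show ?case
    proof (rule Suc.IH[of "\<lambda>k j. c k (Suc j)"])
      show "\<bar>c k (Suc i)\<bar> \<le> B" for k i by (rule Suc.prems)
      fix t :: real assume t: "0 < t" "t < 1"
      have "(\<Sum>j. c k (Suc j) * t ^ j) = ((\<Sum>j. c k j * t ^ j) - c k 0) / t" for k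
        using split[where c = c and k = k, OF t Suc.prems(1)] t by simp
      moreover have "(\<lambda>k. ((\<Sum>j. c k j * t ^ j) - c k 0) / t) \<longlonglongrightarrow> (0 - 0) / t"
        using t by (intro tendsto_intros Suc.prems(2) base[where c = c, OF Suc.prems]) auto
      ultimately show "(\<lambda>k. \<Sum>j. c k (Suc j) * t ^ j) \<longlonglongrightarrow> 0" by simp
    qed
  }
qed

lemma (in prob_space) nat_rv_sums_expectation:
  fixes Y :: "'a \<Rightarrow> nat" and f :: "nat \<Rightarrow> real"
  assumes [measurable]: "random_variable (count_space UNIV) Y"
    and int: "integrable M (\<lambda>\<omega>. f (Y \<omega>))"
  shows "(\<lambda>j. f j * prob {\<omega> \<in> space M. Y \<omega> = j}) sums expectation (\<lambda>\<omega>. f (Y \<omega>))"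
  unfolding sums_def
proof -
  have "(\<Sum>j<n. f j * prob {\<omega> \<in> space M. Y \<omega> = j})
      = expectation (\<lambda>\<omega>. f (Y \<omega>) * indicator {..<n} (Y \<omega>))" for n
  proof -
    have "(\<Sum>j<n. f j * prob {\<omega> \<in> space M. Y \<omega> = j})
        = (\<Sum>j<n. expectation (\<lambda>\<omega>. f j * indicator {\<omega> \<in> space M. Y \<omega> = j} \<omega>))"
      by (simp add: Int_absorb1)
    also have "\<dots> = expectation (\<lambda>\<omega>. \<Sum>j<n. f j * indicator {\<omega> \<in> space M. Y \<omega> = j} \<omega>)"
      by (subst Bochner_Integration.integral_sum) (auto simp: less_top[symmetric])
    also have "\<dots> = expectation (\<lambda>\<omega>. f (Y \<omega>) * indicator {..<n} (Y \<omega>))"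
    proof (rule Bochner_Integration.integral_cong[OF refl])
      fix \<omega> assume "\<omega> \<in> space M"
      then have "(\<Sum>j<n. f j * indicator {\<omega> \<in> space M. Y \<omega> = j} \<omega>) = (\<Sum>j<n. if Y \<omega> = j then f j else 0)"
        by (intro sum.cong) (auto simp: indicator_def)
      also have "\<dots> = f (Y \<omega>) * indicator {..<n} (Y \<omega>)" by (simp add: indicator_def)
      finally show "(\<Sum>j<n. f j * indicator {\<omega> \<in> space M. Y \<omega> = j} \<omega>) = \<dots>" .
    qed
    finally show ?thesis .
  qed
  moreover have "(\<lambda>n. expectation (\<lambda>\<omega>. f (Y \<omega>) * indicator {..<n} (Y \<omega>))) \<longlonglongrightarrow> expectation (\<lambda>\<omega>. f (Y \<omega>))"
  proof (rule integral_dominated_convergence[where w = "\<lambda>\<omega>. \<bar>f (Y \<omega>)\<bar>"])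
    show "integrable M (\<lambda>\<omega>. \<bar>f (Y \<omega>)\<bar>)" using int by simp
    show "AE \<omega> in M. (\<lambda>n. f (Y \<omega>) * indicator {..<n} (Y \<omega>)) \<longlonglongrightarrow> f (Y \<omega>)"
    proof (rule AE_I2)
      fix \<omega>
      have "eventually (\<lambda>n. f (Y \<omega>) * indicator {..<n} (Y \<omega>) = f (Y \<omega>)) sequentially"
        using eventually_gt_at_top[of "Y \<omega>"] by eventually_elim auto
      then show "(\<lambda>n. f (Y \<omega>) * indicator {..<n} (Y \<omega>)) \<longlonglongrightarrow> f (Y \<omega>)" by (rule tendsto_eventually)
    qed
  qed (auto simp: indicator_def)
  ultimately show "(\<lambda>n. \<Sum>j<n. f j * prob {\<omega> \<in> space M. Y \<omega> = j}) \<longlonglongrightarrow> expectation (\<lambda>\<omega>. f (Y \<omega>))"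
    by simp
qed

lemma (in prob_space) cdf_nat_rv:
  assumes [measurable]: "random_variable (count_space UNIV) Y"
  shows "cdf (distr M borel (\<lambda>\<omega>. real (Y \<omega>))) x
    = (\<Sum>j\<in>{j. real j \<le> x}. prob {\<omega> \<in> space M. Y \<omega> = j})"
proof -
  have fin: "finite {j. real j \<le> x}"
    by (rule finite_subset[of _ "{..nat \<lfloor>x\<rfloor>}"]) (auto simp: le_nat_floor)
  have "cdf (distr M borel (\<lambda>\<omega>. real (Y \<omega>))) x = prob {\<omega> \<in> space M. real (Y \<omega>) \<le> x}"
    unfolding cdf_def by (subst measure_distr) (auto intro!: arg_cong[where f = prob])
  also have "{\<omega> \<in> space M. real (Y \<omega>) \<le> x} = (\<Union>j\<in>{j. real j \<le> x}. {\<omega> \<in> space M. Y \<omega> = j})"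
    by auto
  also have "prob \<dots> = (\<Sum>j\<in>{j. real j \<le> x}. prob {\<omega> \<in> space M. Y \<omega> = j})"
    by (rule finite_measure_finite_Union[OF fin]) (auto simp: disjoint_family_on_def)
  finally show ?thesis .
qed

text \<open>The coefficients of the difference of two generating functions are differences of
  probabilities, hence bounded by 1, so the point probabilities converge. For natural-valued
  variables the cdf at any x is a finite sum of these, so it converges at every x.\<close>

lemma converges_in_distribution_pgf:
  fixes X :: "nat \<Rightarrow> 'a \<Rightarrow> nat" and Y :: "'b \<Rightarrow> nat"
  assumes M: "\<And>k. prob_space (M k)" and N: "prob_space N"
    and X: "\<And>k. X k \<in> measurable (M k) (count_space UNIV)"
    and Y: "Y \<in> measurable N (count_space UNIV)"
    and lim: "\<And>t :: real. 0 < t \<Longrightarrow> t < 1 \<Longrightarrow>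
      (\<lambda>k. \<integral>\<omega>. t ^ X k \<omega> \<partial>M k) \<longlonglongrightarrow> (\<integral>\<omega>. t ^ Y \<omega> \<partial>N)"
  shows "converges_in_distribution M (\<lambda>k \<omega>. real (X k \<omega>)) N (\<lambda>\<omega>. real (Y \<omega>))"
proof -
  define p where "p k j = measure (M k) {\<omega> \<in> space (M k). X k \<omega> = j}" for k j
  define r where "r j = measure N {\<omega> \<in> space N. Y \<omega> = j}" for j
  have "(\<lambda>k. p k j - r j) \<longlonglongrightarrow> 0" for j
  proof (rule power_series_coeff_tendsto_0[where B = 1])
    show "\<bar>p k j - r j\<bar> \<le> 1" for k j
    proof -
      have "0 \<le> p k j" "p k j \<le> 1" "0 \<le> r j" "r j \<le> 1"
        using prob_space.prob_le_1[OF M] prob_space.prob_le_1[OF N] by (auto simp: p_def r_def)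
      then show ?thesis by linarith
    qed
    fix t :: real assume t: "0 < t" "t < 1"
    have pow: "norm (t ^ i) \<le> 1" for i using t by (simp add: power_le_one)
    have 1: "(\<lambda>j. t ^ j * p k j) sums (\<integral>\<omega>. t ^ X k \<omega> \<partial>M k)" for k
      unfolding p_def
      by (rule prob_space.nat_rv_sums_expectation[OF M X])
        (use X[of k] pow M[of k] in \<open>auto intro!: finite_measure.integrable_const_bound[where B = 1] prob_space.finite_measure\<close>)
    have 2: "(\<lambda>j. t ^ j * r j) sums (\<integral>\<omega>. t ^ Y \<omega> \<partial>N)"
      unfolding r_def
      by (rule prob_space.nat_rv_sums_expectation[OF N Y])
        (use Y pow N in \<open>auto intro!: finite_measure.integrable_const_bound[where B = 1] prob_space.finite_measure\<close>)
    have "(\<Sum>j. (p k j - r j) * t ^ j) = (\<integral>\<omega>. t ^ X k \<omega> \<partial>M k) - (\<integral>\<omega>. t ^ Y \<omega> \<partial>N)" for k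
      using sums_diff[OF 1[of k] 2] by (simp add: sums_iff algebra_simps)
    then show "(\<lambda>k. \<Sum>j. (p k j - r j) * t ^ j) \<longlonglongrightarrow> 0"
      using tendsto_diff[OF lim[OF t] tendsto_const[of "\<integral>\<omega>. t ^ Y \<omega> \<partial>N"]] by simp
  qed
  then have "(\<lambda>k. p k j) \<longlonglongrightarrow> r j" for j by (simp add: LIM_zero_iff)
  then show ?thesis
    unfolding converges_in_distribution_def weak_conv_m_def weak_conv_def
      prob_space.cdf_nat_rv[OF M X] prob_space.cdf_nat_rv[OF N Y] p_def r_def
    by (auto intro!: tendsto_sum)
qed

section \<open>The generating function of the compound Poisson sum\<close>

text \<open>The floor undoes the embedding into the reals. This lets measurability of sums and
  counts be proved with the closure properties of Borel functions.\<close>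

lemma measurable_count_space_real_of_nat:
  fixes f :: "'a \<Rightarrow> nat"
  assumes "(\<lambda>x. real (f x)) \<in> borel_measurable M"
  shows "f \<in> measurable M (count_space UNIV)"
proof -
  have "(\<lambda>x. nat \<lfloor>real (f x)\<rfloor>) \<in> measurable M (count_space UNIV)"
    using assms by measurable
  then show ?thesis by simp
qed

lemma (in prob_space) measurable_partial_sum:
  fixes Y :: "nat \<Rightarrow> 'a \<Rightarrow> nat"
  assumes "\<And>i. 1 \<le> i \<Longrightarrow> random_variable (count_space UNIV) (Y i)"
  shows "random_variable (count_space UNIV) (\<lambda>\<omega>. \<Sum>j=1..i. Y j \<omega>)"
proof (rule measurable_count_space_real_of_nat)
  show "random_variable borel (\<lambda>\<omega>. real (\<Sum>j=1..i. Y j \<omega>))"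
    unfolding of_nat_sum using assms by (intro borel_measurable_sum) auto
qed

lemma (in prob_space) measurable_random_sum:
  fixes Y :: "nat \<Rightarrow> 'a \<Rightarrow> nat"
  assumes L: "random_variable (count_space UNIV) L"
    and Y: "\<And>i. 1 \<le> i \<Longrightarrow> random_variable (count_space UNIV) (Y i)"
  shows "random_variable (count_space UNIV) (\<lambda>\<omega>. \<Sum>j=1..L \<omega>. Y j \<omega>)"
  using measurable_compose_countable[where f = "\<lambda>i \<omega>. \<Sum>j=1..i. Y j \<omega>",
      OF measurable_partial_sum[OF Y] L] .

text \<open>On the event \<open>L = i\<close> the sum has a fixed number of terms, and independence
  makes its contribution P(L = i) g^i. Against the Poisson weights these add up to exp(l g)
  exp(-l).\<close>

lemma (in prob_space) expectation_pgf_poisson_sum: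
  fixes Y :: "nat \<Rightarrow> 'a \<Rightarrow> nat" and L :: "'a \<Rightarrow> nat"
  assumes Y: "indep_vars (\<lambda>_. count_space UNIV) Y {1..}"
    and Lm[measurable]: "random_variable (count_space UNIV) L"
    and L: "distr M (count_space UNIV) L = measure_pmf (poisson_pmf l)"
    and l: "0 < l"
    and ind: "indep_set
           (sets (vimage_algebra (space M) L (count_space UNIV)))
           (sets (vimage_algebra (space M) (\<lambda>\<omega>. \<lambda>i\<in>{1..}. Y i \<omega>)
             (\<Pi>\<^sub>M i\<in>{1..}. count_space UNIV)))"
    and pgf: "\<And>i. 1 \<le> i \<Longrightarrow> expectation (\<lambda>\<omega>. t ^ Y i \<omega>) = g"
    and t: "0 < t" "t < 1"
  shows "expectation (\<lambda>\<omega>. t ^ (\<Sum>j=1..L \<omega>. Y j \<omega>)) = exp (- l * (1 - g))"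
proof -
  have Ym: "random_variable (count_space UNIV) (Y i)" if "1 \<le> i" for i
    using Y that by (auto simp: indep_vars_def)
  have Sm[measurable]: "random_variable (count_space UNIV) (\<lambda>\<omega>. \<Sum>j=1..i. Y j \<omega>)" for i
    by (rule measurable_partial_sum[OF Ym])
  have sm: "random_variable (count_space UNIV) (\<lambda>\<omega>. \<Sum>j=1..L \<omega>. Y j \<omega>)"
    by (rule measurable_random_sum[OF Lm Ym])
  have pow: "norm (t ^ i) \<le> 1" for i using t by (simp add: power_le_one)
  have bdd: "integrable M (\<lambda>\<omega>. t ^ V \<omega>)" if [measurable]: "random_variable (count_space UNIV) V" for V :: "'a \<Rightarrow> nat"
    by (rule integrable_const_bound[where B = 1]) (use pow in auto)
  have prodE: "expectation (\<lambda>\<omega>. t ^ (\<Sum>j=1..i. Y j \<omega>)) = g ^ i" for i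
  proof (cases "i = 0")
    case False
    have "indep_vars (\<lambda>_. borel) (\<lambda>j \<omega>. t ^ Y j \<omega>) {1..i}"
      by (rule indep_vars_compose2[OF indep_vars_subset[OF Y]]) auto
    then have "expectation (\<lambda>\<omega>. \<Prod>j=1..i. t ^ Y j \<omega>) = (\<Prod>j=1..i. expectation (\<lambda>\<omega>. t ^ Y j \<omega>))"
      using Ym by (intro indep_vars_lebesgue_integral) (auto intro!: bdd)
    also have "\<dots> = (\<Prod>j=1..i. g)" by (rule prod.cong) (auto simp: pgf)
    finally show ?thesis by (simp add: power_sum)
  qed (simp add: prob_space)
  have pL: "prob {\<omega> \<in> space M. L \<omega> = i} = l ^ i / fact i * exp (- l)" for i
  proof -
    have "prob {\<omega> \<in> space M. L \<omega> = i} = measure (distr M (count_space UNIV) L) {i}"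
      by (subst measure_distr) (auto intro!: arg_cong[where f = prob])
    also have "\<dots> = l ^ i / fact i * exp (- l)"
      using l unfolding L by (auto simp: measure_pmf_single)
    finally show ?thesis .
  qed
  have slice: "expectation (\<lambda>\<omega>. indicator {i} (L \<omega>) * t ^ (\<Sum>j=1..i. Y j \<omega>)) = prob {\<omega> \<in> space M. L \<omega> = i} * g ^ i" for i
  proof -
    let ?VL = "vimage_algebra (space M) L (count_space UNIV)"
    let ?VY = "vimage_algebra (space M) (\<lambda>\<omega>. \<lambda>i\<in>{1..}. Y i \<omega>) (\<Pi>\<^sub>M i\<in>{1..}. count_space UNIV)"
    have "L \<in> measurable ?VL (count_space UNIV)" by (rule measurable_vimage_algebra1) auto
    then have mL: "(\<lambda>\<omega>. indicator {i} (L \<omega>) :: real) \<in> borel_measurable ?VL"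
      by (rule measurable_compose) auto
    have "(\<lambda>\<omega>. \<lambda>i\<in>{1..}. Y i \<omega>) \<in> measurable ?VY (\<Pi>\<^sub>M i\<in>{1..}. count_space UNIV)"
      by (rule measurable_vimage_algebra1) (auto simp: space_PiM)
    moreover have "(\<lambda>v. \<Prod>j=1..i. t ^ v j) \<in> borel_measurable (\<Pi>\<^sub>M i\<in>{1..}. count_space UNIV)"
      by (intro borel_measurable_prod measurable_compose[OF measurable_component_singleton]) auto
    ultimately have "(\<lambda>\<omega>. \<Prod>j=1..i. t ^ (\<lambda>i\<in>{1..}. Y i \<omega>) j) \<in> borel_measurable ?VY"
      by (rule measurable_compose)
    then have mY: "(\<lambda>\<omega>. t ^ (\<Sum>j=1..i. Y j \<omega>)) \<in> borel_measurable ?VY"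
      by (simp add: power_sum)
    \<comment> \<open>One function is measurable for the sigma-algebra generated by
      \<open>L\<close>, the other for that of the whole sequence. Their own sigma-algebras are
      therefore contained in the two of \<open>ind\<close> and inherit independence.\<close>
    have *: "indep_var borel (\<lambda>\<omega>. indicator {i} (L \<omega>)) borel (\<lambda>\<omega>. t ^ (\<Sum>j=1..i. Y j \<omega>))"
      unfolding indep_var_eq
    proof (intro conjI)
      show "indep_set (sigma_sets (space M) {(\<lambda>\<omega>. indicator {i} (L \<omega>) :: real) -` A \<inter> space M |A. A \<in> sets borel})
          (sigma_sets (space M) {(\<lambda>\<omega>. t ^ (\<Sum>j=1..i. Y j \<omega>)) -` A \<inter> space M |A. A \<in> sets borel})"
        unfolding sets_vimage_algebra[symmetric] indep_set_def
      proof (rule indep_sets_mono_sets[OF ind[unfolded indep_set_def]])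
        fix b
        show "(case b of True \<Rightarrow> sets (vimage_algebra (space M) (\<lambda>\<omega>. indicator {i} (L \<omega>) :: real) borel)
            | False \<Rightarrow> sets (vimage_algebra (space M) (\<lambda>\<omega>. t ^ (\<Sum>j=1..i. Y j \<omega>)) borel))
          \<subseteq> (case b of True \<Rightarrow> sets ?VL | False \<Rightarrow> sets ?VY)"
          using sets_image_in_sets[OF _ mL, of "space M"] sets_image_in_sets[OF _ mY, of "space M"]
          by (cases b) auto
      qed
      show "random_variable borel (\<lambda>\<omega>. indicator {i} (L \<omega>) :: real)"
        by (rule measurable_compose[OF Lm]) auto
      show "random_variable borel (\<lambda>\<omega>. t ^ (\<Sum>j=1..i. Y j \<omega>))"
        by (rule measurable_compose[OF Sm]) auto
    qed
    have "expectation (\<lambda>\<omega>. indicator {i} (L \<omega>) * t ^ (\<Sum>j=1..i. Y j \<omega>))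
        = expectation (\<lambda>\<omega>. indicator {i} (L \<omega>)) * expectation (\<lambda>\<omega>. t ^ (\<Sum>j=1..i. Y j \<omega>))"
    proof (rule indep_var_lebesgue_integral[OF * _ bdd[OF Sm]])
      have "random_variable borel (\<lambda>\<omega>. indicator {i} (L \<omega>) :: real)"
        by (rule measurable_compose[OF Lm]) auto
      then show "integrable M (\<lambda>\<omega>. indicator {i} (L \<omega>) :: real)"
        by (intro integrable_const_bound[where B = 1]) auto
    qed
    moreover have "expectation (\<lambda>\<omega>. indicator {i} (L \<omega>) :: real) = prob {\<omega> \<in> space M. L \<omega> = i}"
    proof -
      have "expectation (\<lambda>\<omega>. indicator {i} (L \<omega>) :: real)
          = expectation (indicator {\<omega> \<in> space M. L \<omega> = i})"
        by (rule Bochner_Integration.integral_cong) (auto simp: indicator_def)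
      then show ?thesis by (simp add: Int_absorb1)
    qed
    ultimately show ?thesis by (simp only: prodE)
  qed
  have "(\<lambda>i. expectation (\<lambda>\<omega>. indicator {i} (L \<omega>) * t ^ (\<Sum>j=1..i. Y j \<omega>)))
      sums expectation (\<lambda>\<omega>. t ^ (\<Sum>j=1..L \<omega>. Y j \<omega>))"
    unfolding sums_def
  proof -
    have "(\<Sum>i<n. expectation (\<lambda>\<omega>. indicator {i} (L \<omega>) * t ^ (\<Sum>j=1..i. Y j \<omega>)))
       = expectation (\<lambda>\<omega>. indicator {..<n} (L \<omega>) * t ^ (\<Sum>j=1..L \<omega>. Y j \<omega>))" for n
    proof -
      have "(\<Sum>i<n. expectation (\<lambda>\<omega>. indicator {i} (L \<omega>) * t ^ (\<Sum>j=1..i. Y j \<omega>)))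
         = expectation (\<lambda>\<omega>. \<Sum>i<n. indicator {i} (L \<omega>) * t ^ (\<Sum>j=1..i. Y j \<omega>))"
      proof (rule Bochner_Integration.integral_sum[symmetric])
        fix i
        have "random_variable borel (\<lambda>\<omega>. indicator {i} (L \<omega>) :: real)"
          by (rule measurable_compose[OF Lm]) auto
        moreover have "random_variable borel (\<lambda>\<omega>. t ^ (\<Sum>j=1..i. Y j \<omega>))"
          by (rule measurable_compose[OF Sm]) auto
        ultimately show "integrable M (\<lambda>\<omega>. indicator {i} (L \<omega>) * t ^ (\<Sum>j=1..i. Y j \<omega>))"
          using pow by (intro integrable_const_bound[where B = 1] borel_measurable_times)
            (auto simp: indicator_def)
      qed
      also have "(\<lambda>\<omega>. \<Sum>i<n. indicator {i} (L \<omega>) * t ^ (\<Sum>j=1..i. Y j \<omega>))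
        = (\<lambda>\<omega>. \<Sum>i<n. if L \<omega> = i then t ^ (\<Sum>j=1..i. Y j \<omega>) else 0)"
        by (intro ext sum.cong) (auto simp: indicator_def)
      also have "\<dots> = (\<lambda>\<omega>. indicator {..<n} (L \<omega>) * t ^ (\<Sum>j=1..L \<omega>. Y j \<omega>))"
        by (intro ext) (auto simp: indicator_def)
      finally show ?thesis .
    qed
    moreover have "(\<lambda>n. expectation (\<lambda>\<omega>. indicator {..<n} (L \<omega>) * t ^ (\<Sum>j=1..L \<omega>. Y j \<omega>)))
       \<longlonglongrightarrow> expectation (\<lambda>\<omega>. t ^ (\<Sum>j=1..L \<omega>. Y j \<omega>))"
    proof (rule integral_dominated_convergence[where w = "\<lambda>_. 1"])
      show "AE \<omega> in M. (\<lambda>n. indicator {..<n} (L \<omega>) * t ^ (\<Sum>j=1..L \<omega>. Y j \<omega>)) \<longlonglongrightarrow> t ^ (\<Sum>j=1..L \<omega>. Y j \<omega>)"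
      proof (rule AE_I2, rule tendsto_eventually)
        fix \<omega>
        show "\<forall>\<^sub>F n in sequentially. indicator {..<n} (L \<omega>) * t ^ (\<Sum>j=1..L \<omega>. Y j \<omega>) = t ^ (\<Sum>j=1..L \<omega>. Y j \<omega>)"
          using eventually_gt_at_top[of "L \<omega>"] by eventually_elim auto
      qed
      show tm: "random_variable borel (\<lambda>\<omega>. t ^ (\<Sum>j=1..L \<omega>. Y j \<omega>))"
        by (rule measurable_compose[OF sm]) auto
      have "random_variable borel (\<lambda>\<omega>. indicator {..<n} (L \<omega>) :: real)" for n
        by (rule measurable_compose[OF Lm]) auto
      then show "random_variable borel (\<lambda>\<omega>. indicator {..<n} (L \<omega>) * t ^ (\<Sum>j=1..L \<omega>. Y j \<omega>))" for n
        using tm by (rule borel_measurable_times)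
    qed (use pow in \<open>auto simp: indicator_def\<close>)
    ultimately show "(\<lambda>n. \<Sum>i<n. expectation (\<lambda>\<omega>. indicator {i} (L \<omega>) * t ^ (\<Sum>j=1..i. Y j \<omega>)))
      \<longlonglongrightarrow> expectation (\<lambda>\<omega>. t ^ (\<Sum>j=1..L \<omega>. Y j \<omega>))"
      by simp
  qed
  moreover have "(\<lambda>i. l ^ i / fact i * exp (- l) * g ^ i) sums (exp (l * g) * exp (- l))"
  proof -
    have "(\<lambda>i. (l * g) ^ i /\<^sub>R fact i * exp (- l)) sums (exp (l * g) * exp (- l))"
      by (intro sums_mult2 exp_converges)
    then show ?thesis by (simp add: power_mult_distrib field_simps)
  qed
  ultimately have "expectation (\<lambda>\<omega>. t ^ (\<Sum>j=1..L \<omega>. Y j \<omega>)) = exp (l * g) * exp (- l)"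
    unfolding slice pL by (rule sums_unique2)
  then show "expectation (\<lambda>\<omega>. t ^ (\<Sum>j=1..L \<omega>. Y j \<omega>)) = exp (- l * (1 - g))"
    by (simp add: exp_add[symmetric] algebra_simps)
qed

section \<open>Avoidance probabilities of random subsets, and elementary limits\<close>

text \<open>Both sides count pairs of disjoint subsets of sizes r and a in an M-set. The identity
  makes avoidance symmetric: a fixed a-set is missed by a random r-set as often as a fixed r-set by
  a random a-set.\<close>

lemma choose_mult_choose_diff:
  fixes M a r :: nat
  shows "(M choose r) * ((M - r) choose a) = (M choose a) * ((M - a) choose r)"
proof (cases "r + a \<le> M")
  case True
  then obtain k where k: "M = r + a + k" by (metis le_add_diff_inverse)
  have "fact r * (fact a * fact k * ((M - r) choose a)) * (M choose r) = (fact M :: nat)"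
    using binomial_fact_lemma[of r M] binomial_fact_lemma[of a "M - r"] by (simp add: k)
  moreover have "fact a * (fact r * fact k * ((M - a) choose r)) * (M choose a) = (fact M :: nat)"
    using binomial_fact_lemma[of a M] binomial_fact_lemma[of r "M - a"] by (simp add: k ac_simps)
  ultimately have "(fact r * fact a * fact k) * ((M choose r) * ((M - r) choose a))
      = (fact r * fact a * fact k) * ((M choose a) * ((M - a) choose r))"
    by (simp add: ac_simps)
  then show ?thesis by simp
next
  case False
  then show ?thesis by (cases "r \<le> M"; cases "a \<le> M") (auto simp: binomial_eq_0)
qed

text \<open>The probability that a uniformly random a-subset of an M-set misses a given r-subset.\<close>
definition avoid :: "nat \<Rightarrow> nat \<Rightarrow> nat \<Rightarrow> real" where
  "avoid M a r = real ((M - r) choose a) / real (M choose a)"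

lemma avoid_nonneg: "0 \<le> avoid M a r"
  by (simp add: avoid_def)

lemma avoid_antimono: "r \<le> s \<Longrightarrow> avoid M a s \<le> avoid M a r"
  unfolding avoid_def by (intro divide_right_mono of_nat_mono binomial_right_mono) auto

lemma avoid_0: "a \<le> M \<Longrightarrow> avoid M a 0 = 1"
  by (simp add: avoid_def)

lemma avoid_le_1: "a \<le> M \<Longrightarrow> avoid M a r \<le> 1"
  using avoid_antimono[of 0 r M a] by (simp add: avoid_0)

text \<open>Given that the random a-set misses r points, it is uniform among the a-subsets of the
  remaining M - r points, so it contains the next point with probability a/(M - r).\<close>

lemma avoid_Suc:
  assumes "r + a < M"
  shows "avoid M a (Suc r) = avoid M a r * (1 - real a / (real M - real r))"
proof -
  have "real (M - r - a) * real ((M - r) choose a) = real (M - r) * real ((M - r - 1) choose a)"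
    using binomial_absorb_comp[of "M - r" a] by (metis of_nat_mult)
  then have "real ((M - Suc r) choose a) = real ((M - r) choose a) * (1 - real a / (real M - real r))"
    using assms by (simp add: of_nat_diff field_simps)
  then show ?thesis by (simp add: avoid_def)
qed

lemma avoid_tendsto_power:
  assumes t: "0 < t" "t < 1"
    and M: "filterlim M at_top sequentially"
    and a: "(\<lambda>k. real (a k) / real (M k)) \<longlonglongrightarrow> 1 - t"
  shows "(\<lambda>k. avoid (M k) (a k) r) \<longlonglongrightarrow> t ^ r"
proof (induction r)
  case 0
  have "eventually (\<lambda>k. real (a k) / real (M k) < 1) sequentially"
    using order_tendstoD(2)[OF a, of 1] t by simp
  moreover have "eventually (\<lambda>k. M k > 0) sequentially"
    using filterlim_at_top[THEN iffD1, OF M, rule_format, of 1] by (simp add: Suc_le_eq)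
  ultimately have "eventually (\<lambda>k. avoid (M k) (a k) 0 = 1) sequentially"
    by eventually_elim (auto intro!: avoid_0 simp: field_simps)
  then show ?case by (simp add: tendsto_eventually)
next
  case (Suc r)
  have Mr: "filterlim (\<lambda>k. real (M k)) at_top sequentially"
    using filterlim_compose[OF filterlim_real_sequentially M] .
  have q: "(\<lambda>k. real r / real (M k)) \<longlonglongrightarrow> 0"
    by (rule real_tendsto_divide_at_top[OF tendsto_const Mr])
  \<comment> \<open>Because 1 - t < 1, eventually r + a < M, which is the range in which
    \<open>avoid_Suc\<close> applies.\<close>
  have "(\<lambda>k. real (a k) / real (M k) + real r / real (M k)) \<longlonglongrightarrow> 1 - t + 0"
    by (intro tendsto_add a q)
  then have "eventually (\<lambda>k. real (a k) / real (M k) + real r / real (M k) < 1) sequentially"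
    using t by (intro order_tendstoD(2)[where y = "1 - t + 0"]) auto
  moreover have "eventually (\<lambda>k. M k > 0) sequentially"
    using filterlim_at_top[THEN iffD1, OF M, rule_format, of 1] by (simp add: Suc_le_eq)
  ultimately have ev: "eventually (\<lambda>k. avoid (M k) (a k) r *
      (1 - (real (a k) / real (M k)) / (1 - real r / real (M k))) = avoid (M k) (a k) (Suc r)) sequentially"
  proof eventually_elim
    case (elim k)
    then have "real r + real (a k) < real (M k)" by (simp add: field_simps)
    then have "r + a k < M k" by linarith
    with avoid_Suc[OF this] elim show ?case by (simp add: field_simps)
  qed
  have "(\<lambda>k. avoid (M k) (a k) r * (1 - (real (a k) / real (M k)) / (1 - real r / real (M k))))
      \<longlonglongrightarrow> t ^ r * (1 - (1 - t) / (1 - 0))"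
    by (intro tendsto_intros Suc a q) auto
  then show ?case
    using Lim_transform_eventually[OF _ ev] by (simp add: mult.commute)
qed

text \<open>Polya's argument: pointwise convergence of decreasing functions is uniform, because the limit vanishes at infinity.\<close>
lemma avoid_uniform_power:
  assumes t: "0 < t" "t < 1" and e: "0 < e"
    and M: "filterlim M at_top sequentially"
    and a: "(\<lambda>k. real (a k) / real (M k)) \<longlonglongrightarrow> 1 - t"
  shows "eventually (\<lambda>k. \<forall>r. \<bar>avoid (M k) (a k) r - t ^ r\<bar> < e) sequentially"
proof -
  obtain R where R: "t ^ R < e / 2"
    using real_arch_pow_inv[of "e / 2" t] t e by auto
  have "eventually (\<lambda>k. \<forall>r\<in>{..R}. \<bar>avoid (M k) (a k) r - t ^ r\<bar> < e / 2) sequentially"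
  proof (intro eventually_ball_finite ballI)
    show "eventually (\<lambda>k. \<bar>avoid (M k) (a k) r - t ^ r\<bar> < e / 2) sequentially" for r
      using tendstoD[OF avoid_tendsto_power[OF t M a, of r], of "e / 2"] e by (simp add: dist_real_def)
  qed simp
  then show ?thesis
  proof eventually_elim
    case (elim k)
    show ?case
    proof
      fix r
      show "\<bar>avoid (M k) (a k) r - t ^ r\<bar> < e"
      proof (cases "r \<le> R")
        case True
        then show ?thesis using elim e by force
      next
        \<comment> \<open>Both functions decrease in r, so beyond \<open>R\<close> both values lie
          between 0 and e: one is at most t^R < e/2, the other is below t^R + e/2.\<close>
        case False
        then have "avoid (M k) (a k) r \<le> avoid (M k) (a k) R" by (intro avoid_antimono) auto
        moreover have "avoid (M k) (a k) R < t ^ R + e / 2" using elim[rule_format, of R] by (auto simp: abs_if split: if_splits)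
        moreover have "t ^ r \<le> t ^ R" using False t by (intro power_decreasing) auto
        moreover have "0 \<le> avoid (M k) (a k) r" "0 \<le> t ^ r" using t by (auto simp: avoid_nonneg)
        ultimately show ?thesis using R by linarith
      qed
    qed
  qed
qed

text \<open>Comparison with (1 - c/n)^n through |x^n - y^n| <= n |x - y|, valid for |x|, |y| <= 1.
  The difference is then at most |n q - c|, without logarithms.\<close>

lemma one_minus_power_tendsto_exp:
  assumes n: "filterlim n at_top sequentially"
    and q: "\<And>k. 0 \<le> q k" "\<And>k. q k \<le> 1"
    and nq: "(\<lambda>k. real (n k) * q k) \<longlonglongrightarrow> c"
  shows "(\<lambda>k. (1 - q k) ^ n k) \<longlonglongrightarrow> exp (- c)"
proof -
  have nr: "filterlim (\<lambda>k. real (n k)) at_top sequentially"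
    using filterlim_compose[OF filterlim_real_sequentially n] .
  have c: "0 \<le> c"
    by (rule LIMSEQ_le_const[OF nq]) (use q in auto)
  have "(\<lambda>k. (1 + (- c) / real (n k)) ^ n k) \<longlonglongrightarrow> exp (- c)"
    using filterlim_compose[OF tendsto_exp_limit_sequentially n] .
  moreover have "(\<lambda>k. (1 - q k) ^ n k - (1 + (- c) / real (n k)) ^ n k) \<longlonglongrightarrow> 0"
  proof (rule Lim_null_comparison)
    show "(\<lambda>k. \<bar>real (n k) * q k - c\<bar>) \<longlonglongrightarrow> 0"
      using nq by (simp add: tendsto_rabs_zero_iff LIM_zero_iff)
    \<comment> \<open>Once n exceeds c, the base 1 - c/n lies in [0,1], as the power estimate
      demands.\<close>
    have "eventually (\<lambda>k. real (n k) > c) sequentially"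
      using nr by (simp add: filterlim_at_top_dense)
    then show "eventually (\<lambda>k. norm ((1 - q k) ^ n k - (1 + (- c) / real (n k)) ^ n k)
        \<le> \<bar>real (n k) * q k - c\<bar>) sequentially"
    proof eventually_elim
      case (elim k)
      have "c / real (n k) \<le> 1" "0 \<le> c / real (n k)" using elim c by (auto simp: field_simps)
      then have "norm ((1 - q k) ^ n k - (1 + (- c) / real (n k)) ^ n k)
          \<le> real (n k) * norm ((1 - q k) - (1 + (- c) / real (n k)))"
        using q[of k] by (intro norm_power_diff) auto
      also have "\<dots> = \<bar>real (n k) * ((1 - q k) - (1 + (- c) / real (n k)))\<bar>"
        by (simp add: abs_mult)
      also have "real (n k) * ((1 - q k) - (1 + (- c) / real (n k))) = - (real (n k) * q k - c)"
        using elim c by (simp add: field_simps)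
      finally show ?case by simp
    qed
  qed
  ultimately show ?thesis
    using tendsto_add by fastforce
qed

section \<open>A single graph: hitting probabilities and the degree of vertex 1\<close>

text \<open>\<open>expectation_hit\<close> uses this forwards for the sets containing 1 and meeting
  \<open>A\<close>, and backwards for the full power set, so that two expectations can be compared
  size by size.\<close>

lemma sum_Pow_by_card:
  fixes c g :: "nat \<Rightarrow> real"
  assumes W: "finite W" and \<Q>: "\<Q> \<subseteq> Pow W"
    and num: "\<And>s. s \<le> card W \<Longrightarrow> real (card {B \<in> \<Q>. card B = s}) = c s"
  shows "(\<Sum>B\<in>\<Q>. g (card B)) = (\<Sum>s\<le>card W. c s * g s)"
proof -
  have fin: "finite \<Q>" using W \<Q> by (meson finite_Pow_iff finite_subset)
  have sub: "card ` \<Q> \<subseteq> {..card W}" using W \<Q> by (auto intro: card_mono)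
  have "(\<Sum>B\<in>\<Q>. g (card B)) = (\<Sum>s\<in>{..card W}. \<Sum>B\<in>{B \<in> \<Q>. card B = s}. g (card B))"
    by (rule sum.group[symmetric, OF fin _ sub]) simp
  also have "\<dots> = (\<Sum>s\<le>card W. c s * g s)"
    by (rule sum.cong) (auto simp: num[symmetric])
  finally show ?thesis .
qed

text \<open>Deleting v leaves an r-subset of V, and B meets A exactly when this r-subset is not
  contained in V - A, because v lies outside A.\<close>

lemma card_subsets_containing:
  assumes "finite V" "v \<notin> V" "A \<subseteq> V"
  shows "card {B. B \<subseteq> insert v V \<and> v \<in> B \<and> B \<inter> A \<noteq> {} \<and> card B = Suc r}
      = ((card V choose r) - ((card V - card A) choose r))"
proof -
  have fA: "finite A" using assms finite_subset by blast
  let ?S = "\<lambda>U. {C. C \<subseteq> U \<and> card C = r}"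
  have "{B. B \<subseteq> insert v V \<and> v \<in> B \<and> B \<inter> A \<noteq> {} \<and> card B = Suc r}
      = insert v ` (?S V - ?S (V - A))"
  proof (intro set_eqI iffI)
    fix B assume B: "B \<in> {B. B \<subseteq> insert v V \<and> v \<in> B \<and> B \<inter> A \<noteq> {} \<and> card B = Suc r}"
    then have "finite B" using assms by (auto intro: finite_subset)
    with B have "card (B - {v}) = r" by simp
    moreover have "B = insert v (B - {v})" using B by auto
    moreover have "B - {v} \<subseteq> V" using B by auto
    moreover have "\<not> B - {v} \<subseteq> V - A" using B assms by auto
    ultimately show "B \<in> insert v ` (?S V - ?S (V - A))" by blast
  next
    fix B assume "B \<in> insert v ` (?S V - ?S (V - A))"
    then obtain C where C: "B = insert v C" "C \<subseteq> V" "card C = r" "\<not> C \<subseteq> V - A" by auto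
    have "finite C" "v \<notin> C" using C assms finite_subset by blast+
    then show "B \<in> {B. B \<subseteq> insert v V \<and> v \<in> B \<and> B \<inter> A \<noteq> {} \<and> card B = Suc r}"
      using C assms by auto
  qed
  moreover have "inj_on (insert v) (?S V - ?S (V - A))"
    using assms by (auto simp: inj_on_def)
  moreover have "card (?S V - ?S (V - A)) = card (?S V) - card (?S (V - A))"
    using assms by (intro card_Diff_subset) (auto intro: finite_subset[of _ "Pow V"])
  ultimately show ?thesis
    using assms fA by (simp add: card_image n_subsets card_Diff_subset)
qed

text \<open>A real-valued 0/1 function, so that the product of
  \<open>1 - hit A (D j \<omega>)\<close> over j is the indicator that no
  \<open>D j \<omega>\<close> joins vertex 1 to \<open>A\<close>; expectations of such products
  factor by independence.\<close>

definition hit :: "nat set \<Rightarrow> nat set \<Rightarrow> real" where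
  "hit A B = (if 1 \<in> B \<and> B \<inter> A \<noteq> {} then 1 else 0)"

locale passive_sets = prob_space M
  for M :: "'a measure" and n m :: nat and P :: "nat pmf" and D :: "nat \<Rightarrow> 'a \<Rightarrow> nat set" +
  assumes random_sets: "passive_random_sets M n m P D"
    and m_pos: "1 \<le> m" and n_pos: "1 \<le> n"
begin

lemma indep: "indep_vars (\<lambda>_. count_space (Pow {1..m})) D {1..n}"
  using random_sets by (simp add: passive_random_sets_def)

lemma measurable_D: "i \<in> {1..n} \<Longrightarrow> random_variable (count_space (Pow {1..m})) (D i)"
  using indep by (auto simp: indep_vars_def)

lemma D_subset: "i \<in> {1..n} \<Longrightarrow> \<omega> \<in> space M \<Longrightarrow> D i \<omega> \<subseteq> {1..m}"
  using measurable_space[OF measurable_D] by auto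

lemma prob_D: "i \<in> {1..n} \<Longrightarrow> A \<subseteq> {1..m} \<Longrightarrow>
    prob {\<omega> \<in> space M. D i \<omega> = A} = pmf P (card A) / real (m choose card A)"
  using random_sets by (simp add: passive_random_sets_def)

lemma measurable_comp_D:
  "i \<in> {1..n} \<Longrightarrow> (\<lambda>\<omega>. f (D i \<omega>) :: real) \<in> borel_measurable M"
  by (rule measurable_compose[OF measurable_D]) auto

text \<open>\<open>D i\<close> takes finitely many values, so every function of it is bounded. This
  covers the unbounded-looking integrands with \<open>card (D i \<omega>)\<close>.\<close>

lemma integrable_comp_D:
  fixes f :: "nat set \<Rightarrow> real"
  assumes "i \<in> {1..n}"
  shows "integrable M (\<lambda>\<omega>. f (D i \<omega>))"
proof (rule integrable_const_bound[where B = "Max ((\<lambda>A. \<bar>f A\<bar>) ` Pow {1..m})"])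
  show "AE \<omega> in M. norm (f (D i \<omega>)) \<le> Max ((\<lambda>A. \<bar>f A\<bar>) ` Pow {1..m})"
    using D_subset[OF assms] by (intro AE_I2) auto
qed (rule measurable_comp_D[OF assms])

lemma expectation_comp_D:
  fixes f :: "nat set \<Rightarrow> real"
  assumes i: "i \<in> {1..n}"
  shows "expectation (\<lambda>\<omega>. f (D i \<omega>))
    = (\<Sum>A\<in>Pow {1..m}. f A * (pmf P (card A) / real (m choose card A)))"
proof -
  have ev: "{\<omega> \<in> space M. D i \<omega> = A} \<in> events" if "A \<subseteq> {1..m}" for A
  proof -
    have "D i -` {A} \<inter> space M \<in> events"
      by (rule measurable_sets[OF measurable_D[OF i]]) (use that in auto)
    also have "D i -` {A} \<inter> space M = {\<omega> \<in> space M. D i \<omega> = A}" by auto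
    finally show ?thesis .
  qed
  have "expectation (\<lambda>\<omega>. f (D i \<omega>))
      = expectation (\<lambda>\<omega>. \<Sum>A\<in>Pow {1..m}. f A * indicator {\<omega> \<in> space M. D i \<omega> = A} \<omega>)"
  proof (rule Bochner_Integration.integral_cong[OF refl])
    fix \<omega> assume \<omega>: "\<omega> \<in> space M"
    have "(\<Sum>A\<in>Pow {1..m}. f A * indicator {\<omega> \<in> space M. D i \<omega> = A} \<omega>)
        = (\<Sum>A\<in>Pow {1..m}. if A = D i \<omega> then f A else 0)"
      using \<omega> by (intro sum.cong) (auto simp: indicator_def)
    also have "\<dots> = f (D i \<omega>)" using D_subset[OF i \<omega>] by simp
    finally show "f (D i \<omega>) = (\<Sum>A\<in>Pow {1..m}. f A * indicator {\<omega> \<in> space M. D i \<omega> = A} \<omega>)" ..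
  qed
  also have "\<dots> = (\<Sum>A\<in>Pow {1..m}. f A * prob {\<omega> \<in> space M. D i \<omega> = A})"
    using ev by (subst Bochner_Integration.integral_sum) (auto simp: less_top[symmetric] Int_absorb1)
  also have "\<dots> = (\<Sum>A\<in>Pow {1..m}. f A * (pmf P (card A) / real (m choose card A)))"
    by (rule sum.cong) (simp_all add: prob_D[OF i])
  finally show ?thesis .
qed

text \<open>Size biasing comes from double counting: an s-subset of the m vertices contains vertex 1 with probability s/m.\<close>
lemma expectation_hit:
  assumes i: "i \<in> {1..n}" and A: "A \<subseteq> {2..m}"
  shows "expectation (\<lambda>\<omega>. hit A (D i \<omega>))
    = expectation (\<lambda>\<omega>. real (card (D i \<omega>)) * (1 - avoid (m - 1) (card A) (card (D i \<omega>) - 1))) / real m"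
proof -
  define F where "F s = pmf P s / real (m choose s)" for s
  define M' a where "M' = m - 1" and "a = card A"
  \<comment> \<open>The number of s-sets containing 1 and meeting \<open>A\<close>: the other s - 1
    elements are chosen among \<open>M'\<close> vertices, but not all outside
    \<open>A\<close>.\<close>
  define cnt where "cnt s = (case s of 0 \<Rightarrow> 0 | Suc r \<Rightarrow> real (M' choose r) - real ((M' - a) choose r))" for s
  have ins: "{1..m} = insert 1 {2..m}" using m_pos by auto
  have "expectation (\<lambda>\<omega>. hit A (D i \<omega>)) = (\<Sum>B\<in>Pow {1..m}. hit A B * F (card B))"
    unfolding F_def by (rule expectation_comp_D[OF i])
  also have "\<dots> = (\<Sum>B\<in>{B. B \<subseteq> {1..m} \<and> 1 \<in> B \<and> B \<inter> A \<noteq> {}}. F (card B))"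
    by (rule sum.mono_neutral_cong_right) (auto simp: hit_def)
  also have "\<dots> = (\<Sum>s\<le>card {1..m}. cnt s * F s)"
  proof (rule sum_Pow_by_card)
    fix s
    show "real (card {B \<in> {B. B \<subseteq> {1..m} \<and> 1 \<in> B \<and> B \<inter> A \<noteq> {}}. card B = s}) = cnt s"
    proof (cases s)
      case 0
      have "{B \<in> {B. B \<subseteq> {1..m} \<and> 1 \<in> B \<and> B \<inter> A \<noteq> {}}. card B = s} = {}"
        using 0 finite_subset[of _ "{1..m}"] by (auto simp: card_eq_0_iff)
      then show ?thesis using 0 by (simp add: cnt_def)
    next
      case (Suc r)
      have "card {B \<in> {B. B \<subseteq> {1..m} \<and> 1 \<in> B \<and> B \<inter> A \<noteq> {}}. card B = s}
          = (M' choose r) - ((M' - a) choose r)"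
        using card_subsets_containing[of "{2..m}" 1 A r, folded ins] A
        by (simp add: Suc M'_def a_def conj_assoc)
      moreover have "(M' - a) choose r \<le> M' choose r" by (rule binomial_right_mono) simp
      ultimately show ?thesis using Suc by (simp add: cnt_def of_nat_diff)
    qed
  qed auto
  also have "\<dots> = (\<Sum>s\<le>card {1..m}. real (m choose s) * (real s * (1 - avoid M' a (s - 1)) * F s)) / real m"
    unfolding sum_divide_distrib
  proof (rule sum.cong[OF refl])
    fix s
    \<comment> \<open>Two identities combine here: absorption, s (m choose s) = m (M' choose s-1),
      produces the factor s/m, and \<open>choose_mult_choose_diff\<close> turns the share of
      (s-1)-sets missing \<open>A\<close> into \<open>avoid\<close>.\<close>
    have "cnt s = real (m choose s) * (real s * (1 - avoid M' a (s - 1))) / real m"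
    proof (cases s)
      case (Suc r)
      have "a \<le> M'" using A card_mono[OF _ A] by (simp add: a_def M'_def)
      then have "M' choose a \<noteq> 0" by simp
      have "real (M' choose r) * real ((M' - r) choose a) = real (M' choose a) * real ((M' - a) choose r)"
        using choose_mult_choose_diff[of M' r a] by (metis of_nat_mult)
      then have "real (M' choose r) * (1 - avoid M' a r) = cnt s"
        using \<open>M' choose a \<noteq> 0\<close> by (simp add: avoid_def cnt_def Suc field_simps)
      moreover have "real s * real (m choose s) = real m * real (M' choose r)"
        using times_binomial_minus1_eq[of s m] Suc by (metis M'_def diff_Suc_1 of_nat_mult zero_less_Suc)
      ultimately have "real (m choose s) * (real s * (1 - avoid M' a r)) = real m * cnt s"
        by (metis mult.assoc mult.commute)
      then show ?thesis using m_pos Suc by simp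
    qed (simp add: cnt_def)
    then show "cnt s * F s = real (m choose s) * (real s * (1 - avoid M' a (s - 1)) * F s) / real m"
      by simp
  qed
  also have "(\<Sum>s\<le>card {1..m}. real (m choose s) * (real s * (1 - avoid M' a (s - 1)) * F s))
      = (\<Sum>B\<in>Pow {1..m}. real (card B) * (1 - avoid M' a (card B - 1)) * F (card B))"
    by (rule sum_Pow_by_card[symmetric]) (auto simp: n_subsets)
  also have "\<dots> = expectation (\<lambda>\<omega>. real (card (D i \<omega>)) * (1 - avoid M' a (card (D i \<omega>) - 1)))"
    unfolding F_def by (rule expectation_comp_D[OF i, symmetric])
  finally show ?thesis by (simp add: M'_def a_def)
qed

abbreviation degree :: "'a \<Rightarrow> nat" where
  "degree \<omega> \<equiv> passive_degree {1..m} n (\<lambda>i. D i \<omega>) 1"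

text \<open>The degree is a finite sum over the other vertices w of 0/1 functions of the
  \<open>D j\<close>: the product of \<open>1 - hit {w} (D j \<omega>)\<close> vanishes exactly when
  w is a neighbour of vertex 1.\<close>

lemma measurable_degree: "random_variable (count_space UNIV) degree"
proof (rule measurable_count_space_real_of_nat)
  have "real (degree \<omega>) = (\<Sum>w\<in>{2..m}. 1 - (\<Prod>j=1..n. 1 - hit {w} (D j \<omega>)))" for \<omega>
  proof -
    have "(\<Prod>j=1..n. 1 - hit {w} (D j \<omega>)) = (if \<exists>j\<in>{1..n}. 1 \<in> D j \<omega> \<and> w \<in> D j \<omega> then 0 else 1)" for w
      by (auto simp: hit_def prod_zero_iff intro!: prod.neutral)
    then have "(\<Sum>w\<in>{2..m}. 1 - (\<Prod>j=1..n. 1 - hit {w} (D j \<omega>)))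
        = (\<Sum>w\<in>{2..m}. if \<exists>j\<in>{1..n}. 1 \<in> D j \<omega> \<and> w \<in> D j \<omega> then 1 else 0)"
      by (intro sum.cong) auto
    also have "\<dots> = real (card {w \<in> {2..m}. \<exists>j\<in>{1..n}. 1 \<in> D j \<omega> \<and> w \<in> D j \<omega>})"
      by (simp add: sum.If_cases Int_def)
    also have "{w \<in> {2..m}. \<exists>j\<in>{1..n}. 1 \<in> D j \<omega> \<and> w \<in> D j \<omega>}
        = {w \<in> {1..m} - {1}. passive_adjacent {1..m} n (\<lambda>i. D i \<omega>) 1 w}"
      using m_pos by (auto simp: passive_adjacent_def)
    finally show ?thesis by (simp add: passive_degree_def)
  qed
  moreover have "random_variable borel (\<lambda>\<omega>. \<Sum>w\<in>{2..m}. 1 - (\<Prod>j=1..n. 1 - hit {w} (D j \<omega>)))"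
    by (intro borel_measurable_sum borel_measurable_diff borel_measurable_const borel_measurable_prod
      measurable_comp_D)
  ultimately show "random_variable borel (\<lambda>\<omega>. real (degree \<omega>))" by simp
qed

text \<open>Both sides are the probability that no vertex of a uniformly random a-subset is adjacent to
  vertex 1: conditionally on the graph it is on the left, and conditionally on the subset on the right.\<close>
lemma expectation_avoid_degree:
  assumes a: "a \<le> m - 1"
  shows "expectation (\<lambda>\<omega>. avoid (m - 1) a (degree \<omega>))
    = (1 - expectation (\<lambda>\<omega>. real (card (D 1 \<omega>)) * (1 - avoid (m - 1) a (card (D 1 \<omega>) - 1))) / real m) ^ n"
    (is "_ = (1 - ?q) ^ n")
proof -
  define \<A> where "\<A> = {A. A \<subseteq> {2..m} \<and> card A = a}"
  have fin: "finite \<A>" by (rule finite_subset[of _ "Pow {2..m}"]) (auto simp: \<A>_def)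
  have card_\<A>: "card \<A> = (m - 1) choose a" by (simp add: \<A>_def n_subsets)
  have pos: "real ((m - 1) choose a) \<noteq> 0" using a by simp
  have pt: "avoid (m - 1) a (degree \<omega>) = (\<Sum>A\<in>\<A>. \<Prod>j=1..n. 1 - hit A (D j \<omega>)) / real ((m - 1) choose a)"
    for \<omega>
  proof -
    \<comment> \<open>\<open>U\<close> is the neighbourhood of vertex 1. The sum counts the a-sets
      disjoint from it, so dividing by the number of all a-sets gives \<open>avoid\<close> at the
      degree.\<close>
    define U where "U = {w \<in> {1..m} - {1}. passive_adjacent {1..m} n (\<lambda>i. D i \<omega>) 1 w}"
    have U: "U \<subseteq> {2..m}" by (auto simp: U_def)
    have "(\<Sum>A\<in>\<A>. \<Prod>j=1..n. 1 - hit A (D j \<omega>)) = (\<Sum>A\<in>\<A>. if A \<inter> U = {} then 1 else 0)"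
    proof (rule sum.cong[OF refl])
      fix A assume "A \<in> \<A>"
      then have "A \<inter> U = {} \<longleftrightarrow> (\<forall>j\<in>{1..n}. \<not> (1 \<in> D j \<omega> \<and> D j \<omega> \<inter> A \<noteq> {}))"
        using m_pos by (fastforce simp: U_def \<A>_def passive_adjacent_def)
      then show "(\<Prod>j=1..n. 1 - hit A (D j \<omega>)) = (if A \<inter> U = {} then 1 else 0)"
        by (auto simp: hit_def intro!: prod.neutral)
    qed
    also have "\<dots> = real (card {A \<in> \<A>. A \<inter> U = {}})"
      using fin by (simp add: sum.If_cases Int_def)
    also have "{A \<in> \<A>. A \<inter> U = {}} = {A. A \<subseteq> {2..m} - U \<and> card A = a}"
      by (auto simp: \<A>_def)
    also have "card \<dots> = (m - 1 - card U) choose a"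
      using U by (simp add: n_subsets card_Diff_subset finite_subset)
    finally show ?thesis by (simp add: avoid_def passive_degree_def U_def)
  qed
  have prod: "integrable M (\<lambda>\<omega>. \<Prod>j=1..n. 1 - hit A (D j \<omega>))"
      "expectation (\<lambda>\<omega>. \<Prod>j=1..n. 1 - hit A (D j \<omega>)) = (1 - ?q) ^ n" if "A \<in> \<A>" for A
  proof -
    have ind: "indep_vars (\<lambda>_. borel) (\<lambda>j \<omega>. 1 - hit A (D j \<omega>)) {1..n}"
      by (rule indep_vars_compose2[OF indep]) auto
    have int: "integrable M (\<lambda>\<omega>. 1 - hit A (D j \<omega>))" if "j \<in> {1..n}" for j
      by (rule integrable_comp_D[OF that])
    show "integrable M (\<lambda>\<omega>. \<Prod>j=1..n. 1 - hit A (D j \<omega>))"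
      by (rule indep_vars_integrable[OF _ ind]) (use int in auto)
    have E: "expectation (\<lambda>\<omega>. 1 - hit A (D j \<omega>)) = 1 - ?q" if j: "j \<in> {1..n}" for j
    proof -
      have "expectation (\<lambda>\<omega>. 1 - hit A (D j \<omega>)) = 1 - expectation (\<lambda>\<omega>. hit A (D j \<omega>))"
        using integrable_comp_D[OF j] by (simp add: prob_space)
      \<comment> \<open>The \<open>D j\<close> share one law, so every factor can be written with
        \<open>D 1\<close>.\<close>
      also have "expectation (\<lambda>\<omega>. hit A (D j \<omega>)) = expectation (\<lambda>\<omega>. hit A (D 1 \<omega>))"
        using expectation_comp_D[OF j, of "hit A"] expectation_comp_D[of 1 "hit A"] n_pos by simp
      also have "\<dots> = ?q"
        using expectation_hit[of 1 A] \<open>A \<in> \<A>\<close> n_pos by (simp add: \<A>_def)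
      finally show ?thesis .
    qed
    have "expectation (\<lambda>\<omega>. \<Prod>j=1..n. 1 - hit A (D j \<omega>)) = (\<Prod>j=1..n. expectation (\<lambda>\<omega>. 1 - hit A (D j \<omega>)))"
      by (rule indep_vars_lebesgue_integral[OF _ ind]) (use int in auto)
    also have "\<dots> = (\<Prod>j=1..n. 1 - ?q)" by (rule prod.cong[OF refl]) (rule E)
    finally show "expectation (\<lambda>\<omega>. \<Prod>j=1..n. 1 - hit A (D j \<omega>)) = (1 - ?q) ^ n" by simp
  qed
  have "expectation (\<lambda>\<omega>. avoid (m - 1) a (degree \<omega>))
      = (\<Sum>A\<in>\<A>. expectation (\<lambda>\<omega>. \<Prod>j=1..n. 1 - hit A (D j \<omega>))) / real ((m - 1) choose a)"
    unfolding pt using prod(1) by (simp add: Bochner_Integration.integral_sum)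
  also have "\<dots> = (\<Sum>A\<in>\<A>. (1 - ?q) ^ n) / real ((m - 1) choose a)"
    by (intro arg_cong2[where f = "(/)"] sum.cong prod(2)) auto
  also have "\<dots> = (1 - ?q) ^ n" using pos by (simp add: card_\<A>)
  finally show ?thesis .
qed

end

section \<open>Consequences of convergence in distribution, and bounds on the hitting
  probability\<close>

lemma converges_in_distribution_expectation:
  fixes f :: "real \<Rightarrow> real"
  assumes M: "\<And>k. prob_space (M k)" and N: "prob_space N"
    and X: "\<And>k. X k \<in> borel_measurable (M k)" and Y: "Y \<in> borel_measurable N"
    and conv: "converges_in_distribution M X N Y"
    and f: "\<And>x. isCont f x" "\<And>x. \<bar>f x\<bar> \<le> B"
  shows "(\<lambda>k. \<integral>\<omega>. f (X k \<omega>) \<partial>M k) \<longlonglongrightarrow> (\<integral>\<omega>. f (Y \<omega>) \<partial>N)"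
proof -
  have "f \<in> borel_measurable borel"
    using f(1) by (intro borel_measurable_continuous_onI continuous_at_imp_continuous_on) auto
  then show ?thesis
    using weak_conv_imp_integral_bdd_continuous_conv[where f = f and B = B,
        OF prob_space.real_distribution_distr[OF M X] prob_space.real_distribution_distr[OF N Y]
          conv[unfolded converges_in_distribution_def] f(1)] f(2) X Y
    by (simp add: integral_distr)
qed

text \<open>The truncated distance to the naturals is bounded and continuous and vanishes at every
  \<open>X k\<close>. Its mean under the limit is therefore 0, and since the naturals are closed,
  the limit lies in them almost surely.\<close>

lemma limit_in_distribution_Nats:
  fixes X :: "nat \<Rightarrow> 'a \<Rightarrow> nat"
  assumes M: "\<And>k. prob_space (M k)" and N: "prob_space N"
    and X: "\<And>k. (\<lambda>\<omega>. real (X k \<omega>)) \<in> borel_measurable (M k)" and Y: "Y \<in> borel_measurable N"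
    and conv: "converges_in_distribution M (\<lambda>k \<omega>. real (X k \<omega>)) N Y"
  shows "AE \<omega> in N. Y \<omega> \<in> \<nat>"
proof -
  define f where "f x = min 1 (infdist x (\<nat> :: real set))" for x
  have f_cont: "isCont f x" for x
    unfolding f_def by (intro continuous_intros)
  have f_bound: "0 \<le> f x" "\<bar>f x\<bar> \<le> 1" for x
    by (auto simp: f_def infdist_nonneg)
  have "(\<lambda>k. \<integral>\<omega>. f (real (X k \<omega>)) \<partial>M k) \<longlonglongrightarrow> (\<integral>\<omega>. f (Y \<omega>) \<partial>N)"
    by (rule converges_in_distribution_expectation[OF M N X Y conv f_cont f_bound(2)])
  then have "(\<integral>\<omega>. f (Y \<omega>) \<partial>N) = 0"
    by (simp add: f_def LIMSEQ_const_iff)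
  moreover have "(\<lambda>\<omega>. f (Y \<omega>)) \<in> borel_measurable N"
    using f_cont Y
    by (intro measurable_compose[OF Y] borel_measurable_continuous_onI continuous_at_imp_continuous_on) auto
  then have "integrable N (\<lambda>\<omega>. f (Y \<omega>))"
    using f_bound(2) prob_space.finite_measure[OF N]
    by (intro finite_measure.integrable_const_bound[where B = 1]) auto
  ultimately have "AE \<omega> in N. f (Y \<omega>) = 0"
    using f_bound(1) by (subst (asm) integral_nonneg_eq_0_iff_AE) auto
  then show ?thesis
  proof eventually_elim
    case (elim \<omega>)
    then have "infdist (Y \<omega>) \<nat> = 0" by (simp add: f_def min_def split: if_splits)
    moreover have "(\<nat> :: real set) \<noteq> {}" using Nats_0 by blast
    ultimately show ?case using in_closed_iff_infdist_zero[of "\<nat> :: real set"] by simp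
  qed
qed

text \<open>By \<open>expectation_hit\<close>, q is the probability that \<open>D 1\<close> contains
  vertex 1 and meets some chosen a-set. Such a set exists among the other m - 1 vertices because a
  <= m - 1.\<close>

lemma (in passive_sets) mean_hit_bounds:
  assumes "a \<le> m - 1"
  defines "q \<equiv> expectation (\<lambda>\<omega>. real (card (D 1 \<omega>)) * (1 - avoid (m - 1) a (card (D 1 \<omega>) - 1))) / real m"
  shows "0 \<le> q" "q \<le> 1"
proof -
  obtain A where A: "A \<subseteq> {2..m}" "card A = a"
    using obtain_subset_with_card_n[of a "{2..m}"] assms by auto
  have 1: "1 \<in> {1..n}" using n_pos by simp
  have q: "q = expectation (\<lambda>\<omega>. hit A (D 1 \<omega>))"
    unfolding q_def expectation_hit[OF 1 A(1)] A(2) ..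
  show "0 \<le> q" unfolding q by (rule integral_nonneg_AE) (simp add: hit_def)
  have "q \<le> expectation (\<lambda>\<omega>. 1)"
    unfolding q by (rule integral_mono[OF integrable_comp_D[OF 1]]) (auto simp: hit_def)
  then show "q \<le> 1" by (simp add: prob_space)
qed

section \<open>The limit of the generating functions of the degrees\<close>

theorem theorem2:
  fixes \<beta> :: real
    and n m :: "nat \<Rightarrow> nat"
    and P :: "nat \<Rightarrow> nat pmf"
    and M :: "nat \<Rightarrow> 'a measure"
    and D :: "nat \<Rightarrow> nat \<Rightarrow> 'a \<Rightarrow> nat set"
    and N :: "'b measure"
    and Z :: "'b \<Rightarrow> real"
    and \<Omega> :: "'c measure"
    and Zt :: "nat \<Rightarrow> 'c \<Rightarrow> nat"
    and \<Lambda> :: "'c \<Rightarrow> nat"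
  assumes "\<beta> > 0"
    and "\<And>k. n k \<ge> 1" and "\<And>k. m k \<ge> 1"
    and "filterlim n at_top sequentially"
    and "filterlim m at_top sequentially"
    and "(\<lambda>k. real (m k) / real (n k)) \<longlonglongrightarrow> \<beta>"
    and "\<And>k. passive_random_sets (M k) (n k) (m k) (P k) (D k)"
    and "prob_space N"
    and "Z \<in> borel_measurable N"
    and "converges_in_distribution M (\<lambda>k \<omega>. real (card (D k 1 \<omega>))) N Z"
    and "integrable N Z" and "0 < prob_space.expectation N Z"
    and "(\<lambda>k. prob_space.expectation (M k) (\<lambda>\<omega>. real (card (D k 1 \<omega>))))
           \<longlonglongrightarrow> prob_space.expectation N Z"
    and "prob_space \<Omega>"
    and "prob_space.indep_vars \<Omega> (\<lambda>_. count_space UNIV) Zt {1..}"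
    and "\<And>i j. i \<ge> 1 \<Longrightarrow>
           measure \<Omega> {\<omega> \<in> space \<Omega>. Zt i \<omega> = j} =
             real (j + 1) * measure N {\<omega> \<in> space N. Z \<omega> = real (j + 1)}
               / prob_space.expectation N Z"
    and "distr \<Omega> (count_space UNIV) \<Lambda> =
           measure_pmf (poisson_pmf (prob_space.expectation N Z / \<beta>))"
    and "prob_space.indep_set \<Omega>
           (sets (vimage_algebra (space \<Omega>) \<Lambda> (count_space UNIV)))
           (sets (vimage_algebra (space \<Omega>) (\<lambda>\<omega>. \<lambda>i\<in>{1..}. Zt i \<omega>)
             (\<Pi>\<^sub>M i\<in>{1..}. count_space UNIV)))"
  shows "converges_in_distribution
           M (\<lambda>k \<omega>. real (passive_degree {1..m k} (n k) (\<lambda>i. D k i \<omega>) 1))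
           \<Omega> (\<lambda>\<omega>. real (\<Sum>j=1..\<Lambda> \<omega>. Zt j \<omega>))"
proof -
  define \<mu> where "\<mu> = (\<integral>\<omega>. Z \<omega> \<partial>N)"
  define X where "X k \<omega> = card (D k 1 \<omega>)" for k \<omega>
  \<comment> \<open>A version of Z with values in the naturals; it agrees with Z almost surely
    (\<open>ZY\<close>).\<close>
  define Y where "Y \<omega> = nat \<lfloor>Z \<omega>\<rfloor>" for \<omega>
  have \<mu>: "0 < \<mu>" using assms(12) by (simp add: \<mu>_def)
  interpret N: prob_space N by fact
  interpret \<Omega>: prob_space \<Omega> by fact
  have ps: "prob_space (M k)" for k using assms(7) by (simp add: passive_random_sets_def)
  interpret G: passive_sets "M k" "n k" "m k" "P k" "D k" for k
    using assms(2,3,7) ps by (auto simp: passive_sets_def passive_sets_axioms_def)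
  have one: "1 \<in> {1..n k}" for k using assms(2) by simp
  note [measurable] = \<open>Z \<in> borel_measurable N\<close>
  have Xm: "(\<lambda>\<omega>. real (X k \<omega>)) \<in> borel_measurable (M k)" for k
    unfolding X_def by (rule G.measurable_comp_D[OF one])
  have Xint: "integrable (M k) (\<lambda>\<omega>. f (X k \<omega>))" for k and f :: "nat \<Rightarrow> real"
    unfolding X_def by (rule G.integrable_comp_D[OF one])
  have conv: "converges_in_distribution M (\<lambda>k \<omega>. real (X k \<omega>)) N Z"
    using assms(10) by (simp add: X_def)
  have EX: "(\<lambda>k. G.expectation k (\<lambda>\<omega>. real (X k \<omega>))) \<longlonglongrightarrow> \<mu>"
    using assms(13) by (simp add: X_def \<mu>_def)
  have ZY: "AE \<omega> in N. Z \<omega> = real (Y \<omega>)"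
    using limit_in_distribution_Nats[OF ps N.prob_space_axioms Xm assms(9) conv]
    by eventually_elim (auto simp: Y_def elim!: Nats_cases)
  have Ym[measurable]: "Y \<in> measurable N (count_space UNIV)"
    unfolding Y_def by measurable
  have pY: "measure N {\<omega> \<in> space N. Y \<omega> = j} = measure N {\<omega> \<in> space N. Z \<omega> = real j}" for j
    by (rule N.finite_measure_eq_AE) (use ZY in \<open>auto elim!: eventually_mono\<close>)
  have Yint: "integrable N (\<lambda>\<omega>. real (Y \<omega>))"
    by (rule Bochner_Integration.integrable_cong_AE_imp[OF assms(11)])
      (use ZY in \<open>auto elim!: eventually_mono\<close>)

  have Ztm: "Zt i \<in> measurable \<Omega> (count_space UNIV)" if "1 \<le> i" for i
    using assms(15) that by (auto simp: \<Omega>.indep_vars_def)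
  \<comment> \<open>Measurability of \<Lambda> is extracted from the independence hypothesis, which
    makes every set of the sigma-algebra generated by \<Lambda> an event.\<close>
  have \<Lambda>m: "\<Lambda> \<in> measurable \<Omega> (count_space UNIV)"
  proof (rule measurableI)
    fix A :: "nat set"
    have "\<Lambda> -` A \<inter> space \<Omega> \<in> sets (vimage_algebra (space \<Omega>) \<Lambda> (count_space UNIV))"
      by (rule in_vimage_algebra) auto
    then show "\<Lambda> -` A \<inter> space \<Omega> \<in> sets \<Omega>" using \<Omega>.indep_setD_ev1[OF assms(18)] by auto
  qed auto
  have Sm: "(\<lambda>\<omega>. \<Sum>j=1..\<Lambda> \<omega>. Zt j \<omega>) \<in> measurable \<Omega> (count_space UNIV)"
    by (rule \<Omega>.measurable_random_sum[OF \<Lambda>m Ztm])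

  have pgf: "(\<lambda>k. G.expectation k (\<lambda>\<omega>. t ^ G.degree k \<omega>))
      \<longlonglongrightarrow> \<Omega>.expectation (\<lambda>\<omega>. t ^ (\<Sum>j=1..\<Lambda> \<omega>. Zt j \<omega>))"
    if t: "0 < t" "t < 1" for t :: real
  proof -
    \<comment> \<open>The derivative of t^j in t, so \<open>Ef\<close> is the derivative of the
      generating function of Z, and \<open>Ef / \<mu>\<close> is the generating function of the size
      biased law. The truncated exponent at j = 0 is harmless, as the factor j vanishes.\<close>
    define f where "f j = real j * t ^ (j - 1)" for j
    define Ef where "Ef = N.expectation (\<lambda>\<omega>. f (Y \<omega>))"
    have f: "0 \<le> f j" "f j \<le> real j" for j
      using t by (auto simp: f_def mult_left_le power_le_one)
    have fY: "integrable N (\<lambda>\<omega>. f (Y \<omega>))"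
      by (rule Bochner_Integration.integrable_bound[OF Yint]) (use f in auto)

    have gZt: "\<Omega>.expectation (\<lambda>\<omega>. t ^ Zt i \<omega>) = Ef / \<mu>" if i: "1 \<le> i" for i
    proof -
      note Zm = Ztm[OF i]
      have "norm (t ^ r) \<le> 1" for r using t by (simp add: power_le_one)
      then have "integrable \<Omega> (\<lambda>\<omega>. t ^ Zt i \<omega>)"
        using Zm by (intro \<Omega>.integrable_const_bound[where B = 1]) auto
      from \<Omega>.nat_rv_sums_expectation[OF Zm this]
      have "(\<lambda>j. t ^ j * (real (j + 1) * measure N {\<omega> \<in> space N. Y \<omega> = j + 1} / \<mu>))
          sums \<Omega>.expectation (\<lambda>\<omega>. t ^ Zt i \<omega>)"
        by (simp only: assms(16)[OF i] pY \<mu>_def)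
      \<comment> \<open>The size biased mass at j comes from the mass of Y at j + 1; starting the
        sum at 1 loses nothing because f 0 = 0.\<close>
      moreover have "(\<lambda>j. f (Suc j) * N.prob {\<omega> \<in> space N. Y \<omega> = Suc j}) sums Ef"
        using N.nat_rv_sums_expectation[OF Ym fY, folded Ef_def]
        by (subst sums_Suc_iff) (simp add: f_def)
      then have "(\<lambda>j. f (Suc j) * N.prob {\<omega> \<in> space N. Y \<omega> = Suc j} / \<mu>) sums (Ef / \<mu>)"
        by (rule sums_divide)
      ultimately show ?thesis
        by (simp add: f_def ac_simps sums_iff)
    qed

    have Ef_lim: "(\<lambda>k. G.expectation k (\<lambda>\<omega>. f (X k \<omega>))) \<longlonglongrightarrow> Ef"
    proof -
      define s where "s = - ln t"
      \<comment> \<open>A continuous extension of f to the reals, since exp(-s|x|) = t^|x|. Absolute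
        values keep it bounded on the negative axis, and y <= exp y with y = s|x| gives the bound
        1/(s t).\<close>
      define F where "F x = \<bar>x\<bar> * exp (- (s * \<bar>x\<bar>)) / t" for x :: real
      have s: "0 < s" using t by (simp add: s_def)
      have F_cont: "isCont F x" for x unfolding F_def using t by (intro continuous_intros) auto
      have F_bound: "\<bar>F x\<bar> \<le> 1 / s / t" for x
      proof -
        have "s * \<bar>x\<bar> \<le> exp (s * \<bar>x\<bar>)" using exp_ge_add_one_self[of "s * \<bar>x\<bar>"] by linarith
        then have "\<bar>x\<bar> * exp (- (s * \<bar>x\<bar>)) \<le> 1 / s"
          using s by (simp add: exp_minus field_simps)
        then have "\<bar>x\<bar> * exp (- (s * \<bar>x\<bar>)) / t \<le> 1 / s / t" using t by (intro divide_right_mono) auto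
        then show ?thesis using t unfolding F_def by (simp add: abs_mult)
      qed
      have Ff: "F (real j) = f j" for j
      proof (cases j)
        case (Suc r)
        have "exp (- (s * real j)) = t ^ j" using t by (simp add: s_def exp_of_nat_mult mult.commute)
        then show ?thesis using t Suc by (simp add: F_def f_def)
      qed (simp add: F_def f_def)
      have "(\<lambda>k. \<integral>\<omega>. F (real (X k \<omega>)) \<partial>M k) \<longlonglongrightarrow> (\<integral>\<omega>. F (Z \<omega>) \<partial>N)"
        by (rule converges_in_distribution_expectation[OF ps N.prob_space_axioms Xm assms(9) conv F_cont F_bound])
      moreover have "(\<integral>\<omega>. F (Z \<omega>) \<partial>N) = Ef"
        unfolding Ef_def
      proof (rule integral_cong_AE)
        show "(\<lambda>\<omega>. F (Z \<omega>)) \<in> borel_measurable N"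
          unfolding F_def by measurable
        show "(\<lambda>\<omega>. f (Y \<omega>)) \<in> borel_measurable N" by (rule borel_measurable_integrable[OF fY])
        show "AE \<omega> in N. F (Z \<omega>) = f (Y \<omega>)"
          using ZY by eventually_elim (simp add: Ff)
      qed
      ultimately show ?thesis by (simp add: Ff)
    qed

    \<comment> \<open>About a fraction 1 - t of the other m - 1 vertices, so that a given vertex is
      missed with probability close to t.\<close>
    define a where "a k = nat \<lfloor>(1 - t) * real (m k - 1)\<rfloor>" for k
    have a_le: "a k \<le> m k - 1" for k
    proof -
      have "(1 - t) * real (m k - 1) \<le> 1 * real (m k - 1)" using t by (intro mult_right_mono) auto
      then show ?thesis unfolding a_def by linarith
    qed
    have m1: "filterlim (\<lambda>k. m k - 1) at_top sequentially"
      unfolding filterlim_at_top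
    proof
      fix r
      have "eventually (\<lambda>k. Suc r \<le> m k) sequentially" using assms(5) by (simp add: filterlim_at_top)
      then show "eventually (\<lambda>k. r \<le> m k - 1) sequentially" by eventually_elim auto
    qed
    have m1r: "filterlim (\<lambda>k. real (m k - 1)) at_top sequentially"
      using filterlim_compose[OF filterlim_real_sequentially m1] .
    have m1pos: "eventually (\<lambda>k. 0 < real (m k - 1)) sequentially"
      using m1r unfolding filterlim_at_top_dense by blast
    have a_lim: "(\<lambda>k. real (a k) / real (m k - 1)) \<longlonglongrightarrow> 1 - t"
    proof (rule tendsto_sandwich)
      have "(\<lambda>k. (1 - t) - 1 / real (m k - 1)) \<longlonglongrightarrow> (1 - t) - 0"
        by (intro tendsto_intros real_tendsto_divide_at_top[OF tendsto_const m1r])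
      then show "(\<lambda>k. (1 - t) - 1 / real (m k - 1)) \<longlonglongrightarrow> 1 - t" by simp
      show "eventually (\<lambda>k. (1 - t) - 1 / real (m k - 1) \<le> real (a k) / real (m k - 1)) sequentially"
        using m1pos
      proof eventually_elim
        case (elim k)
        have "(1 - t) * real (m k - 1) - 1 \<le> real (a k)" unfolding a_def by linarith
        then have "((1 - t) * real (m k - 1) - 1) / real (m k - 1) \<le> real (a k) / real (m k - 1)"
          using elim by (intro divide_right_mono) auto
        then show ?case using elim by (simp add: diff_divide_distrib)
      qed
      show "eventually (\<lambda>k. real (a k) / real (m k - 1) \<le> 1 - t) sequentially"
        using m1pos
      proof eventually_elim
        case (elim k)
        have "0 \<le> (1 - t) * real (m k - 1)" using t by simp
        then have "real (a k) \<le> (1 - t) * real (m k - 1)" unfolding a_def by linarith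
        then show ?case using elim by (simp add: pos_divide_le_eq)
      qed
    qed (rule tendsto_const)

    define h where "h k = avoid (m k - 1) (a k)" for k
    have h_bounds: "0 \<le> h k r" "h k r \<le> 1" for k r
      using avoid_nonneg avoid_le_1[OF a_le] by (auto simp: h_def)
    have h_unif: "eventually (\<lambda>k. \<forall>r. \<bar>h k r - t ^ r\<bar> < e) sequentially" if "0 < e" for e
      unfolding h_def by (rule avoid_uniform_power[OF t that m1 a_lim])

    define q where "q k = G.expectation k (\<lambda>\<omega>. real (X k \<omega>) * (1 - h k (X k \<omega> - 1))) / real (m k)" for k
    have q: "0 \<le> q k" "q k \<le> 1" for k
      using G.mean_hit_bounds[OF a_le] by (auto simp: q_def X_def h_def)
    have Eh: "G.expectation k (\<lambda>\<omega>. h k (G.degree k \<omega>)) = (1 - q k) ^ n k" for k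
      unfolding h_def q_def X_def by (rule G.expectation_avoid_degree[OF a_le])

    have "(\<lambda>k. G.expectation k (\<lambda>\<omega>. real (X k \<omega>) * h k (X k \<omega> - 1))
        - G.expectation k (\<lambda>\<omega>. f (X k \<omega>))) \<longlonglongrightarrow> 0"
    proof (rule tendstoI)
      fix e :: real assume e: "0 < e"
      \<comment> \<open>The uniform error e' is multiplied by E X, which is eventually below \<mu> +
        1 because the means converge.\<close>
      define e' where "e' = e / (\<mu> + 1)"
      have e': "0 < e'" "e' * (\<mu> + 1) = e" using e \<mu> by (auto simp: e'_def)
      have "eventually (\<lambda>k. G.expectation k (\<lambda>\<omega>. real (X k \<omega>)) < \<mu> + 1) sequentially"
        using order_tendstoD(2)[OF EX] by simp
      with h_unif[OF e'(1)]
      show "eventually (\<lambda>k. dist (G.expectation k (\<lambda>\<omega>. real (X k \<omega>) * h k (X k \<omega> - 1))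
        - G.expectation k (\<lambda>\<omega>. f (X k \<omega>))) 0 < e) sequentially"
      proof eventually_elim
        case (elim k)
        have "\<bar>G.expectation k (\<lambda>\<omega>. real (X k \<omega>) * h k (X k \<omega> - 1)) - G.expectation k (\<lambda>\<omega>. f (X k \<omega>))\<bar>
            = \<bar>G.expectation k (\<lambda>\<omega>. real (X k \<omega>) * h k (X k \<omega> - 1) - f (X k \<omega>))\<bar>"
          by (subst Bochner_Integration.integral_diff) (auto intro: Xint)
        also have "\<dots> \<le> G.expectation k (\<lambda>\<omega>. \<bar>real (X k \<omega>) * h k (X k \<omega> - 1) - f (X k \<omega>)\<bar>)"
          by (rule integral_abs_bound)
        also have "\<dots> \<le> G.expectation k (\<lambda>\<omega>. e' * real (X k \<omega>))"
        proof (rule integral_mono)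
          fix \<omega>
          have "\<bar>real (X k \<omega>) * h k (X k \<omega> - 1) - f (X k \<omega>)\<bar>
              = real (X k \<omega>) * \<bar>h k (X k \<omega> - 1) - t ^ (X k \<omega> - 1)\<bar>"
            by (simp add: f_def abs_mult flip: right_diff_distrib)
          also have "\<dots> \<le> real (X k \<omega>) * e'"
            using elim(1) by (intro mult_left_mono) (auto intro: less_imp_le)
          finally show "\<bar>real (X k \<omega>) * h k (X k \<omega> - 1) - f (X k \<omega>)\<bar> \<le> e' * real (X k \<omega>)"
            by (simp add: mult.commute)
        qed (rule Xint)+
        also have "\<dots> = e' * G.expectation k (\<lambda>\<omega>. real (X k \<omega>))" by simp
        also have "\<dots> < e' * (\<mu> + 1)" using elim(2) e'(1) by simp
        finally show ?case using e'(2) by simp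
      qed
    qed
    from tendsto_add[OF this Ef_lim]
    have "(\<lambda>k. G.expectation k (\<lambda>\<omega>. real (X k \<omega>) * h k (X k \<omega> - 1))) \<longlonglongrightarrow> Ef" by simp
    from tendsto_diff[OF EX this]
    have "(\<lambda>k. G.expectation k (\<lambda>\<omega>. real (X k \<omega>) * (1 - h k (X k \<omega> - 1)))) \<longlonglongrightarrow> \<mu> - Ef"
      by (subst (asm) Bochner_Integration.integral_diff[symmetric])
        (auto intro: Xint simp: right_diff_distrib)
    \<comment> \<open>By definition n q is (n/m) times the expectation just treated, and n/m tends
      to 1/\<beta>.\<close>
    from tendsto_mult[OF tendsto_inverse[OF assms(6)] this]
    have "(\<lambda>k. real (n k) * q k) \<longlonglongrightarrow> (\<mu> - Ef) / \<beta>"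
      using assms(1) by (simp add: q_def field_simps)
    from one_minus_power_tendsto_exp[OF assms(4) q this]
    have Eh_lim: "(\<lambda>k. G.expectation k (\<lambda>\<omega>. h k (G.degree k \<omega>))) \<longlonglongrightarrow> exp (- ((\<mu> - Ef) / \<beta>))"
      by (simp only: Eh)

    have "(\<lambda>k. G.expectation k (\<lambda>\<omega>. t ^ G.degree k \<omega>) - G.expectation k (\<lambda>\<omega>. h k (G.degree k \<omega>)))
        \<longlonglongrightarrow> 0"
    proof (rule tendstoI)
      fix e :: real assume e: "0 < e"
      \<comment> \<open>Uniformity in r allows substituting the random degree, with no bound on how
        large it may be.\<close>
      have "eventually (\<lambda>k. \<forall>r. \<bar>h k r - t ^ r\<bar> < e / 2) sequentially" using e by (intro h_unif) simp
      then show "eventually (\<lambda>k. dist (G.expectation k (\<lambda>\<omega>. t ^ G.degree k \<omega>)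
          - G.expectation k (\<lambda>\<omega>. h k (G.degree k \<omega>))) 0 < e) sequentially"
      proof eventually_elim
        case (elim k)
        have int: "integrable (M k) (\<lambda>\<omega>. g (G.degree k \<omega>))"
          if "\<And>r. \<bar>g r\<bar> \<le> B" for g :: "nat \<Rightarrow> real" and B
        proof (rule G.integrable_const_bound[where B = B])
          show "(\<lambda>\<omega>. g (G.degree k \<omega>)) \<in> borel_measurable (M k)"
            by (rule measurable_compose[OF G.measurable_degree]) simp
        qed (use that in simp)
        have "norm (G.expectation k (\<lambda>\<omega>. t ^ G.degree k \<omega> - h k (G.degree k \<omega>)))
            \<le> G.expectation k (\<lambda>\<omega>. \<bar>t ^ G.degree k \<omega> - h k (G.degree k \<omega>)\<bar>)"
          using integral_norm_bound[of "M k" "\<lambda>\<omega>. t ^ G.degree k \<omega> - h k (G.degree k \<omega>)"] by simp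
        also have "\<dots> \<le> G.expectation k (\<lambda>\<omega>. e / 2)"
        proof (rule integral_mono)
          have b: "\<bar>\<bar>t ^ r - h k r\<bar>\<bar> \<le> e / 2" for r
            using elim[rule_format, of r] by linarith
          show "integrable (M k) (\<lambda>\<omega>. \<bar>t ^ G.degree k \<omega> - h k (G.degree k \<omega>)\<bar>)"
            by (rule int[OF b])
          show "\<bar>t ^ G.degree k \<omega> - h k (G.degree k \<omega>)\<bar> \<le> e / 2" for \<omega>
            using b by simp
        qed simp
        also have "\<dots> = e / 2" by (simp add: G.prob_space)
        finally have "norm (G.expectation k (\<lambda>\<omega>. t ^ G.degree k \<omega> - h k (G.degree k \<omega>))) < e"
          using e by linarith
        moreover have "G.expectation k (\<lambda>\<omega>. t ^ G.degree k \<omega> - h k (G.degree k \<omega>))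
            = G.expectation k (\<lambda>\<omega>. t ^ G.degree k \<omega>) - G.expectation k (\<lambda>\<omega>. h k (G.degree k \<omega>))"
        proof (rule Bochner_Integration.integral_diff)
          have "\<bar>t ^ r\<bar> \<le> 1" "\<bar>h k r\<bar> \<le> 1" for r
            using t h_bounds[of k r] by (auto simp: power_le_one)
          then show "integrable (M k) (\<lambda>\<omega>. t ^ G.degree k \<omega>)"
            "integrable (M k) (\<lambda>\<omega>. h k (G.degree k \<omega>))"
            by (intro int; blast)+
        qed
        ultimately show ?case by simp
      qed
    qed
    from tendsto_add[OF this Eh_lim]
    have "(\<lambda>k. G.expectation k (\<lambda>\<omega>. t ^ G.degree k \<omega>)) \<longlonglongrightarrow> exp (- ((\<mu> - Ef) / \<beta>))" by simp
    moreover have "\<Omega>.expectation (\<lambda>\<omega>. t ^ (\<Sum>j=1..\<Lambda> \<omega>. Zt j \<omega>)) = exp (- (\<mu> / \<beta>) * (1 - Ef / \<mu>))"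
      by (rule \<Omega>.expectation_pgf_poisson_sum[OF assms(15) \<Lambda>m assms(17)[folded \<mu>_def] _ assms(18) gZt t])
        (use \<mu> assms(1) in auto)
    moreover have "- (\<mu> / \<beta>) * (1 - Ef / \<mu>) = - ((\<mu> - Ef) / \<beta>)"
      using \<mu> assms(1) by (simp add: field_simps)
    ultimately show ?thesis by (simp only:)
  qed
  show ?thesis
    by (rule converges_in_distribution_pgf[OF ps \<Omega>.prob_space_axioms G.measurable_degree Sm pgf])
qed

end
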